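(* For every real $\varepsilon>0$, there exists a finite simple connected graph $G$ that is not resistance nonnegative (RN) and satisfies $\tau(G)>\frac32-\varepsilon$.
   Context: All graphs are finite, simple and connected. For a graph $G$ and $S\subseteq V(G)$, let $c(G-S)$ be the number of connected components of $G-S$. The toughness of a noncomplete graph $G$ is $\tau(G):=\min\{|S|/c(G-S): S\subseteq V(G),\ c(G-S)>1\}$; complete graphs have infinite toughness. Resistance curvature: let $G=(V,E)$ be a finite simple connected graph, $\mathcal T(G)$ its set of spanning trees, and $c=(c_e)_{e\in E}$ positive edge weights. The relative resistance of an edge $e$ is $$r_e(c):=\frac{\sum_{T\in\mathcal T(G),\, e\in T}\prod_{h\in T}c_h}{\sum_{T\in\mathcal T(G)}\prod_{h\in T}c_h}$$ (equivalently $c_e$ times the effective resistance between the ends of $e$), and the resistance curvature of a vertex $v$ is $p_v(c):=1-\frac12\sum_{e\ni v}r_e(c)$. $G$ is resistance nonnegative (RN) if there exist positive edge weights $c$ with $p_v(c)\ge 0$ for every $v\in V$. *)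

theory Defs
  imports Complex_Main "HOL-Library.Extended_Real"
begin

text \<open>A graph is given by a vertex set \<open>V\<close> and a set \<open>E\<close> of two-element subsets of \<open>V\<close>.\<close>

definition simple_graph :: "'a set \<Rightarrow> 'a set set \<Rightarrow> bool" where
  "simple_graph V E \<longleftrightarrow> finite V \<and> (\<forall>e\<in>E. e \<subseteq> V \<and> card e = 2)"

definition complete_graph :: "'a set \<Rightarrow> 'a set set \<Rightarrow> bool" where
  "complete_graph V E \<longleftrightarrow> (\<forall>u\<in>V. \<forall>v\<in>V. u \<noteq> v \<longrightarrow> {u, v} \<in> E)"

definition reachable :: "'a set \<Rightarrow> 'a set set \<Rightarrow> ('a \<times> 'a) set" where
  "reachable V E = {(u, v). u \<in> V \<and> v \<in> V \<and> (u, v) \<in> {(x, y). {x, y} \<in> E}\<^sup>*}"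

definition components :: "'a set \<Rightarrow> 'a set set \<Rightarrow> 'a set set" where
  "components V E = V // reachable V E"

definition connected_graph :: "'a set \<Rightarrow> 'a set set \<Rightarrow> bool" where
  "connected_graph V E \<longleftrightarrow> V \<noteq> {} \<and> (\<forall>u\<in>V. \<forall>v\<in>V. (u, v) \<in> reachable V E)"

definition num_components_del :: "'a set \<Rightarrow> 'a set set \<Rightarrow> 'a set \<Rightarrow> nat" where
  "num_components_del V E S = card (components (V - S) {e \<in> E. e \<subseteq> V - S})"

definition toughness :: "'a set \<Rightarrow> 'a set set \<Rightarrow> ereal" where
  "toughness V E =
     (if complete_graph V E then \<infinity>
      else ereal (Min {real (card S) / real (num_components_del V E S) | S.
                        S \<subseteq> V \<and> num_components_del V E S > 1}))"

text \<open>A cycle is the list of its distinct vertices in cyclic order.\<close>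

definition is_cycle :: "'a set set \<Rightarrow> 'a list \<Rightarrow> bool" where
  "is_cycle E vs \<longleftrightarrow> length vs \<ge> 3 \<and> distinct vs \<and>
     (\<forall>i<length vs. {vs ! i, vs ! (Suc i mod length vs)} \<in> E)"

definition spanning_trees :: "'a set \<Rightarrow> 'a set set \<Rightarrow> 'a set set set" where
  "spanning_trees V E = {T. T \<subseteq> E \<and> connected_graph V T \<and> (\<nexists>vs. is_cycle T vs)}"

definition relative_resistance ::
    "'a set \<Rightarrow> 'a set set \<Rightarrow> ('a set \<Rightarrow> real) \<Rightarrow> 'a set \<Rightarrow> real" where
  "relative_resistance V E c e =
     (\<Sum>T\<in>{T \<in> spanning_trees V E. e \<in> T}. \<Prod>h\<in>T. c h) /
     (\<Sum>T\<in>spanning_trees V E. \<Prod>h\<in>T. c h)"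

definition resistance_curvature ::
    "'a set \<Rightarrow> 'a set set \<Rightarrow> ('a set \<Rightarrow> real) \<Rightarrow> 'a \<Rightarrow> real" where
  "resistance_curvature V E c v =
     1 - 1 / 2 * (\<Sum>e\<in>{e \<in> E. v \<in> e}. relative_resistance V E c e)"

definition resistance_nonnegative :: "'a set \<Rightarrow> 'a set set \<Rightarrow> bool" where
  "resistance_nonnegative V E \<longleftrightarrow>
     (\<exists>c. (\<forall>e\<in>E. c e > 0) \<and> (\<forall>v\<in>V. resistance_curvature V E c v \<ge> 0))"

end

theory Submission
  imports Defs
begin

text \<open>The relative resistances are the edge marginals of the random spanning tree, so
  \<open>p\<^sub>v \<ge> 0\<close> says that the expected degree of \<open>v\<close> is at most 2. Averaging with vertex weights
  \<open>y \<ge> 0\<close>, some spanning tree has \<open>\<Sum>v. y v * deg v \<le> 2 * (\<Sum>v. y v)\<close>.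
  Take a clique \<open>M\<close> and an independent set \<open>B\<close>, both of size \<open>b = 2 * a + 3\<close>, a perfect matching
  between them, and \<open>a\<close> further vertices \<open>A\<close> adjacent to everything. For the weights 2, 1, 0
  on \<open>A\<close>, \<open>M\<close>, \<open>B\<close>, every edge has total end weight at least 2 except the \<open>b\<close> matching edges,
  of weight 1, so a spanning tree has weight at least \<open>2 * (a + 2 * b - 1) - b > 4 * a + 2 * b\<close>.
  On the other hand a cutset contains \<open>A\<close>, and every further component costs a vertex of \<open>M\<close>, so
  the toughness is about \<open>(a + b) / b\<close>.\<close>

section \<open>Reachability, components and edge counts of connected graphs\<close>

lemma equiv_reachable: "equiv V (reachable V E)"
proof (rule equivI)
  show "reachable V E \<subseteq> V \<times> V"
    by (auto simp: reachable_def)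
  show "refl_on V (reachable V E)"
    by (auto simp: reachable_def refl_on_def)
  have "sym ({(x, y). {x, y} \<in> E}\<^sup>*)"
    by (intro sym_rtrancl) (auto simp: sym_def insert_commute)
  then show "sym (reachable V E)"
    by (auto simp: reachable_def sym_def)
  show "trans (reachable V E)"
    by (auto simp: reachable_def trans_def)
qed

lemma reachable_edge:
  assumes "u \<in> V" "v \<in> V" "{u, v} \<in> E"
  shows "(u, v) \<in> reachable V E"
  using assms by (auto simp: reachable_def)

lemma connected_graphI:
  assumes "x \<in> V" "\<And>v. v \<in> V \<Longrightarrow> (x, v) \<in> reachable V E"
  shows "connected_graph V E"
  using assms equiv_reachable[of V E]
  unfolding connected_graph_def equiv_def by (meson empty_iff symD transD)

lemma connected_graph_mono:
  assumes "connected_graph V T" "T \<subseteq> E"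
  shows "connected_graph V E"
proof -
  have "{(x, y). {x, y} \<in> T}\<^sup>* \<subseteq> {(x, y). {x, y} \<in> E}\<^sup>*"
    using assms(2) by (intro rtrancl_mono) auto
  then show ?thesis
    using assms(1) unfolding connected_graph_def reachable_def by blast
qed

text \<open>Every class is the class of some \<open>r\<close> in \<open>R\<close>. Components are
  only ever counted from above, so \<open>R\<close> may contain redundant points or points outside
  \<open>V\<close>.\<close>

lemma card_components_le:
  assumes "finite R" "\<And>v. v \<in> V \<Longrightarrow> \<exists>r\<in>R. (r, v) \<in> reachable V E"
  shows "card (components V E) \<le> card R"
proof -
  have "components V E \<subseteq> (\<lambda>r. reachable V E `` {r}) ` R"
  proof
    fix C assume "C \<in> components V E"
    then obtain v where v: "v \<in> V" "C = reachable V E `` {v}"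
      by (auto simp: components_def quotient_def)
    then obtain r where "r \<in> R" "(r, v) \<in> reachable V E"
      using assms(2) by blast
    then show "C \<in> (\<lambda>r. reachable V E `` {r}) ` R"
      using v equiv_class_eq[OF equiv_reachable] by (metis imageI)
  qed
  then show ?thesis
    using assms(1) by (meson card_image_le card_mono finite_imageI order_trans)
qed

lemma connected_graph_exit_edge:
  assumes "connected_graph V T" "W \<subseteq> V" "W \<noteq> {}" "W \<noteq> V"
  obtains x y where "x \<in> W" "y \<notin> W" "{x, y} \<in> T"
proof -
  obtain u v where uv: "u \<in> W" "v \<in> V" "v \<notin> W"
    using assms by blast
  then have "(u, v) \<in> {(x, y). {x, y} \<in> T}\<^sup>*"
    using assms by (auto simp: connected_graph_def reachable_def)
  moreover have "z \<in> W \<or> (\<exists>x y. x \<in> W \<and> y \<notin> W \<and> {x, y} \<in> T)"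
    if "(u, z) \<in> {(x, y). {x, y} \<in> T}\<^sup>*" for z
    using that by (induction rule: rtrancl_induct) (use uv(1) in auto)
  ultimately show ?thesis
    using uv that by blast
qed

text \<open>Growing a vertex set from a single point costs one new edge per vertex. Applied to a
  spanning tree, this is the edge count behind its weight bound.\<close>

lemma card_connected_graph_le:
  assumes "finite V" "finite T" "\<And>e. e \<in> T \<Longrightarrow> e \<subseteq> V" "connected_graph V T"
  shows "card V \<le> Suc (card T)"
proof -
  have grow: "\<exists>W F. W \<subseteq> V \<and> card W = Suc k \<and> F \<subseteq> T \<and> (\<forall>e\<in>F. e \<subseteq> W) \<and> card F = k"
    if "Suc k \<le> card V" for k
    using that
  proof (induction k)
    case 0
    then obtain v where "v \<in> V"
      by fastforce
    then show ?case
      by (intro exI[of _ "{v}"] exI[of _ "{}"]) auto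
  next
    case (Suc k)
    then obtain W F where W: "W \<subseteq> V" "card W = Suc k" and F: "F \<subseteq> T" "\<forall>e\<in>F. e \<subseteq> W" "card F = k"
      by auto
    have fin: "finite W" "finite F"
      using finite_subset[OF W(1) assms(1)] finite_subset[OF F(1) assms(2)] by auto
    have "W \<noteq> {}" "W \<noteq> V"
      using W(2) Suc.prems by auto
    then obtain x y where xy: "x \<in> W" "y \<notin> W" "{x, y} \<in> T"
      using connected_graph_exit_edge[OF assms(4) W(1)] by blast
    \<comment> \<open>The edges of \<open>F\<close> stay inside \<open>W\<close>, so an edge leaving
      \<open>W\<close> is new.\<close>
    have "{x, y} \<notin> F"
      using xy F by auto
    then show ?case
      using W F xy fin assms(3)[of "{x, y}"]
      by (intro exI[of _ "insert y W"] exI[of _ "insert {x, y} F"]) auto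
  qed
  show ?thesis
  proof (cases "card V")
    case (Suc k)
    then obtain F where "F \<subseteq> T" "card F = k"
      using grow[of k] by auto
    then show ?thesis
      using Suc assms(2) card_mono by fastforce
  qed simp
qed

section \<open>Spanning trees and weighted averages of their degrees\<close>

lemma star_spanning_tree:
  assumes "x \<in> V" "\<And>v. v \<in> V \<Longrightarrow> v \<noteq> x \<Longrightarrow> {x, v} \<in> E"
  shows "(\<lambda>v. {x, v}) ` (V - {x}) \<in> spanning_trees V E"
proof -
  let ?T = "(\<lambda>v. {x, v}) ` (V - {x})"
  have "connected_graph V ?T"
  proof (rule connected_graphI)
    fix v assume "v \<in> V"
    then show "(x, v) \<in> reachable V ?T"
      using assms(1) by (cases "v = x") (auto intro: reachable_edge simp: reachable_def)
  qed (rule assms(1))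
  moreover have False if cyc: "is_cycle ?T vs" for vs
  proof -
    let ?n = "length vs"
    have n: "?n \<ge> 3" and d: "distinct vs"
      and e: "\<And>i. i < ?n \<Longrightarrow> {vs ! i, vs ! (Suc i mod ?n)} \<in> ?T"
      using cyc by (auto simp: is_cycle_def)
    have x: "x = vs ! i \<or> x = vs ! (Suc i mod ?n)" if "i < ?n" for i
      using e[OF that] by (auto simp: doubleton_eq_iff)
    have lt: "0 < ?n" "1 < ?n" "2 < ?n" "3 mod ?n < ?n"
      using n mod_less_divisor[of ?n 3] by linarith+
    \<comment> \<open>Three consecutive edges already cannot share \<open>x\<close>. The index
      \<open>3 mod ?n\<close> covers the triangle, where the third edge returns to
      \<open>vs ! 0\<close>.\<close>
    have *: "x = vs ! 0 \<or> x = vs ! 1" "x = vs ! 1 \<or> x = vs ! 2" "x = vs ! 2 \<or> x = vs ! (3 mod ?n)"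
    proof -
      have "Suc 0 mod ?n = 1" "Suc 1 mod ?n = 2" "Suc 2 mod ?n = 3 mod ?n"
        using n by simp_all
      then show "x = vs ! 0 \<or> x = vs ! 1" "x = vs ! 1 \<or> x = vs ! 2" "x = vs ! 2 \<or> x = vs ! (3 mod ?n)"
        using x[OF lt(1)] x[OF lt(2)] x[OF lt(3)] by simp_all
    qed
    have "3 mod ?n \<noteq> 1"
      using n by (cases "?n = 3") auto
    then have ne: "vs ! 0 \<noteq> vs ! 1" "vs ! 0 \<noteq> vs ! 2" "vs ! 1 \<noteq> vs ! 2" "vs ! 1 \<noteq> vs ! (3 mod ?n)"
      using lt d by (simp_all add: nth_eq_iff_index_eq)
    show False
      using * ne by argo
  qed
  ultimately show ?thesis
    using assms(2) by (auto simp: spanning_trees_def)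
qed

text \<open>Linear duality for the degree condition: in a random tree drawn with probability
  proportional to \<open>?P T\<close>, the expectation of the edge sum equals the
  \<open>y\<close>-weighted sum of expected degrees, each at most 2.\<close>

lemma resistance_nonnegative_weight_bound:
  fixes y :: "'a \<Rightarrow> real"
  assumes G: "simple_graph V E" and ne: "spanning_trees V E \<noteq> {}"
    and RN: "resistance_nonnegative V E"
    and y: "\<And>v. v \<in> V \<Longrightarrow> y v \<ge> 0"
    and K: "\<And>T. T \<in> spanning_trees V E \<Longrightarrow> K \<le> (\<Sum>e\<in>T. \<Sum>v\<in>e. y v)"
  shows "K \<le> 2 * (\<Sum>v\<in>V. y v)"
proof -
  obtain c where c: "\<And>e. e \<in> E \<Longrightarrow> c e > 0"
    and curv: "\<And>v. v \<in> V \<Longrightarrow> resistance_curvature V E c v \<ge> 0"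
    using RN by (auto simp: resistance_nonnegative_def)
  let ?S = "spanning_trees V E"
  let ?P = "\<lambda>T. \<Prod>h\<in>T. c h"
  let ?r = "relative_resistance V E c"
  let ?w = "\<lambda>e. \<Sum>v\<in>e. y v"
  define Z where "Z = (\<Sum>T\<in>?S. ?P T)"
  have finV: "finite V" and E: "\<And>e. e \<in> E \<Longrightarrow> e \<subseteq> V"
    using G by (auto simp: simple_graph_def)
  have finE: "finite E"
    using finV E by (meson Pow_iff finite_Pow_iff finite_subset subsetI)
  have sub: "T \<subseteq> E" if "T \<in> ?S" for T
    using that by (auto simp: spanning_trees_def)
  have finS: "finite ?S"
    using finE sub by (meson Pow_iff finite_Pow_iff finite_subset subsetI)
  have Ppos: "?P T > 0" if "T \<in> ?S" for T
    using sub[OF that] c by (intro prod_pos) auto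
  have Z: "Z > 0"
    unfolding Z_def using finS ne Ppos by (intro sum_pos) auto
  have "K * Z = (\<Sum>T\<in>?S. ?P T * K)"
    by (simp add: Z_def sum_distrib_left mult.commute)
  also have "\<dots> \<le> (\<Sum>T\<in>?S. ?P T * (\<Sum>e\<in>T. ?w e))"
    using K Ppos by (intro sum_mono mult_left_mono) (auto intro: less_imp_le)
  \<comment> \<open>Writing \<open>T\<close> as a restriction of \<open>E\<close> prepares the
    exchange of the two sums, after which the inner sum over trees through \<open>e\<close> is
    \<open>Z * ?r e\<close>.\<close>
  also have "\<dots> = (\<Sum>T\<in>?S. \<Sum>e\<in>{e \<in> E. e \<in> T}. ?P T * ?w e)"
  proof (rule sum.cong)
    fix T assume "T \<in> ?S"
    then have "{e \<in> E. e \<in> T} = T"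
      using sub by auto
    then show "?P T * (\<Sum>e\<in>T. ?w e) = (\<Sum>e\<in>{e \<in> E. e \<in> T}. ?P T * ?w e)"
      by (simp add: sum_distrib_left)
  qed simp
  also have "\<dots> = (\<Sum>e\<in>E. \<Sum>T\<in>{T \<in> ?S. e \<in> T}. ?P T * ?w e)"
    using finS finE by (rule sum.swap_restrict)
  also have "\<dots> = (\<Sum>e\<in>E. Z * ?r e * ?w e)"
    using Z by (simp add: relative_resistance_def Z_def[symmetric] sum_distrib_right)
  also have "\<dots> = Z * (\<Sum>e\<in>E. \<Sum>v\<in>{v \<in> V. v \<in> e}. y v * ?r e)"
  proof -
    have "{v \<in> V. v \<in> e} = e" if "e \<in> E" for e
      using E[OF that] by auto
    then show ?thesis
      by (simp add: sum_distrib_left sum_distrib_right mult_ac cong: sum.cong)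
  qed
  also have "(\<Sum>e\<in>E. \<Sum>v\<in>{v \<in> V. v \<in> e}. y v * ?r e) =
      (\<Sum>v\<in>V. \<Sum>e\<in>{e \<in> E. v \<in> e}. y v * ?r e)"
    using finE finV by (rule sum.swap_restrict)
  \<comment> \<open>Nonnegative curvature at \<open>v\<close> says that the \<open>?r e\<close> over
    the edges at \<open>v\<close> sum to at most 2.\<close>
  also have "\<dots> \<le> (\<Sum>v\<in>V. y v * 2)"
    unfolding sum_distrib_left[symmetric]
    using curv y by (intro sum_mono mult_left_mono) (auto simp: resistance_curvature_def)
  finally have "K * Z \<le> Z * (\<Sum>v\<in>V. y v * 2)"
    using Z by simp
  then show ?thesis
    using Z by (simp add: sum_distrib_right[symmetric] mult.commute)
qed

section \<open>Bounding toughness from below\<close>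

text \<open>Delete everything except two nonadjacent vertices. This keeps the \<open>Min\<close> in
  \<open>toughness\<close> from ranging over the empty set.\<close>

lemma noncomplete_cutset:
  assumes "simple_graph V E" "\<not> complete_graph V E"
  obtains S where "S \<subseteq> V" "num_components_del V E S > 1"
proof -
  obtain u v where uv: "u \<in> V" "v \<in> V" "u \<noteq> v" "{u, v} \<notin> E"
    using assms(2) by (auto simp: complete_graph_def)
  let ?U = "{u, v}"
  have U: "V - (V - ?U) = ?U"
    using uv by auto
  have "e = ?U" if "e \<in> E" "e \<subseteq> ?U" for e
    using that assms(1) uv by (intro card_subset_eq) (auto simp: simple_graph_def)
  then have F: "{e \<in> E. e \<subseteq> ?U} = {}"
    using uv by blast
  have "reachable ?U {} = Id_on ?U"
    by (auto simp: reachable_def Id_on_def)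
  then have "components ?U {} = {{u}, {v}}"
    by (auto simp: components_def quotient_def)
  then have "num_components_del V E (V - ?U) = 2"
    using uv unfolding num_components_del_def U F by simp
  then show ?thesis
    using that[of "V - ?U"] by simp
qed

lemma toughness_greaterI:
  assumes G: "simple_graph V E"
    and t: "\<And>S. S \<subseteq> V \<Longrightarrow> num_components_del V E S > 1 \<Longrightarrow>
      t < real (card S) / real (num_components_del V E S)"
  shows "toughness V E > ereal t"
proof (cases "complete_graph V E")
  case False
  let ?X = "{real (card S) / real (num_components_del V E S) | S.
    S \<subseteq> V \<and> num_components_del V E S > 1}"
  have "finite (Pow V)"
    using G by (simp add: simple_graph_def)
  moreover have "?X \<subseteq> (\<lambda>S. real (card S) / real (num_components_del V E S)) ` Pow V"
    by auto
  ultimately have "finite ?X"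
    by (meson finite_imageI finite_subset)
  moreover obtain S where "S \<subseteq> V" "num_components_del V E S > 1"
    using noncomplete_cutset[OF G False] by blast
  then have "?X \<noteq> {}"
    by auto
  ultimately have "t < Min ?X"
    using t by auto
  then show ?thesis
    using False by (simp add: toughness_def)
qed (simp add: toughness_def)

section \<open>The graphs built from a hub set, a clique and a matched independent set\<close>

text \<open>On the vertices \<open>{..<a + 2 * b}\<close>, the sets \<open>A\<close>, \<open>M\<close>, \<open>B\<close> are the intervals \<open>{..<a}\<close>,
  \<open>{a..<a + b}\<close> and \<open>{a + b..<a + 2 * b}\<close>.\<close>

definition matched_edges :: "nat \<Rightarrow> nat \<Rightarrow> nat set set" where
  "matched_edges a b = {{u, v} | u v. u < v \<and> v < a + 2 * b \<and> (u < a \<or> v < a + b \<or> v = u + b)}"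

lemma matched_edges_iff:
  assumes "u < v"
  shows "{u, v} \<in> matched_edges a b \<longleftrightarrow> v < a + 2 * b \<and> (u < a \<or> v < a + b \<or> v = u + b)"
  using assms by (auto simp: matched_edges_def doubleton_eq_iff)

lemma simple_graph_matched: "simple_graph {..<a + 2 * b} (matched_edges a b)"
  by (auto simp: simple_graph_def matched_edges_def)

lemma matched_edges_hub:
  assumes "x < a" "v < a + 2 * b" "v \<noteq> x"
  shows "{x, v} \<in> matched_edges a b"
proof (cases "x < v")
  case True
  then show ?thesis
    using assms by (simp add: matched_edges_iff)
next
  case False
  then have "{v, x} \<in> matched_edges a b"
    using assms by (simp add: matched_edges_iff)
  then show ?thesis
    by (simp add: insert_commute)
qed

lemma matched_edges_clique:
  assumes "u < a + b" "v < a + b" "u \<noteq> v"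
  shows "{u, v} \<in> matched_edges a b"
  using assms matched_edges_iff[of u v a b] matched_edges_iff[of v u a b]
  by (cases "u < v") (auto simp: insert_commute)

lemma spanning_trees_matched_nonempty:
  assumes "a > 0"
  shows "spanning_trees {..<a + 2 * b} (matched_edges a b) \<noteq> {}"
  using star_spanning_tree[of 0 "{..<a + 2 * b}" "matched_edges a b"] matched_edges_hub[of 0 a]
    assms by fastforce

lemma spanning_tree_matched_weight:
  fixes a b :: nat and y :: "nat \<Rightarrow> real"
  defines "y \<equiv> \<lambda>v. if v < a then 2 else if v < a + b then 1 else 0"
  assumes T: "T \<in> spanning_trees {..<a + 2 * b} (matched_edges a b)"
  shows "2 * (real a + 2 * real b - 1) - real b \<le> (\<Sum>e\<in>T. \<Sum>v\<in>e. y v)"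
proof -
  let ?V = "{..<a + 2 * b}"
  let ?N = "(\<lambda>u. {u, u + b}) ` {a..<a + b}"
  have sub: "T \<subseteq> matched_edges a b" and conn: "connected_graph ?V T"
    using T by (auto simp: spanning_trees_def)
  have V: "e \<subseteq> ?V" if "e \<in> T" for e
    using that sub simple_graph_matched[of a b] by (auto simp: simple_graph_def)
  have fin: "finite T"
    using V by (meson Pow_iff finite_Pow_iff finite_lessThan finite_subset subsetI)
  have "card (T \<inter> ?N) \<le> card ?N"
    by (intro card_mono) auto
  also have "card ?N \<le> b"
    using card_image_le[of "{a..<a + b}" "\<lambda>u. {u, u + b}"] by simp
  finally have N: "card (T \<inter> ?N) \<le> b" .
  \<comment> \<open>An edge that avoids \<open>A\<close> and is not inside \<open>M\<close> must be
    a matching edge, the only kind of end weight 1.\<close>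
  have "2 - of_bool (e \<in> ?N) \<le> (\<Sum>v\<in>e. y v)" if eT: "e \<in> T" for e
  proof -
    obtain u v where uv: "e = {u, v}" "u < v" "v < a + 2 * b" "u < a \<or> v < a + b \<or> v = u + b"
      using eT sub by (auto simp: matched_edges_def)
    have "{u, v} \<in> ?N" if "\<not> u < a" "\<not> v < a + b"
      using that uv by auto
    moreover have "(\<Sum>v\<in>e. y v) = y u + y v"
      using uv by simp
    ultimately show ?thesis
      using uv by (cases "u < a"; cases "v < a + b") (auto simp: y_def)
  qed
  then have ge: "(\<Sum>e\<in>T. 2 - of_bool (e \<in> ?N)) \<le> (\<Sum>e\<in>T. \<Sum>v\<in>e. y v)"
    by (intro sum_mono)
  have "a + 2 * b \<le> Suc (card T)"
    using card_connected_graph_le[OF _ fin V conn] by simp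
  then have "2 * a + 4 * b + card (T \<inter> ?N) \<le> 2 * card T + b + 2"
    using N by linarith
  then have "real (2 * a + 4 * b + card (T \<inter> ?N)) \<le> real (2 * card T + b + 2)"
    by (rule of_nat_mono)
  then have "2 * (real a + 2 * real b - 1) - real b \<le> 2 * real (card T) - real (card (T \<inter> ?N))"
    by simp
  also have "\<dots> = (\<Sum>e\<in>T. 2 - of_bool (e \<in> ?N))"
    using fin by (simp add: sum_subtractf Int_def)
  also note ge
  finally show ?thesis .
qed

text \<open>The weight bound would give \<open>2 * a + 3 * b - 2 \<le> 4 * a + 2 * b\<close>, that
  is, \<open>b \<le> 2 * a + 2\<close>.\<close>

lemma not_resistance_nonnegative_matched:
  assumes "a > 0" "b > 2 * a + 2"
  shows "\<not> resistance_nonnegative {..<a + 2 * b} (matched_edges a b)"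
proof
  assume RN: "resistance_nonnegative {..<a + 2 * b} (matched_edges a b)"
  define y :: "nat \<Rightarrow> real" where "y = (\<lambda>v. if v < a then 2 else if v < a + b then 1 else 0)"
  have "2 * (real a + 2 * real b - 1) - real b \<le> 2 * (\<Sum>v\<in>{..<a + 2 * b}. y v)"
    using simple_graph_matched spanning_trees_matched_nonempty[OF assms(1)] RN
    by (rule resistance_nonnegative_weight_bound)
      (use spanning_tree_matched_weight in \<open>auto simp: y_def\<close>)
  moreover have "(\<Sum>v\<in>{..<a + 2 * b}. y v) = 2 * real a + real b"
  proof -
    have "sum y {..<a + 2 * b} = sum y {0..<a} + sum y {a..<a + b} + sum y {a + b..<a + 2 * b}"
      by (simp add: sum.atLeastLessThan_concat lessThan_atLeast0)
    moreover have "sum y {0..<a} = 2 * a" "sum y {a..<a + b} = b" "sum y {a + b..<a + 2 * b} = 0"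
      by (simp_all add: y_def)
    ultimately show ?thesis
      by simp
  qed
  ultimately show False
    using of_nat_less_iff[where 'a = real, THEN iffD2, OF assms(2)] by simp
qed

text \<open>If \<open>j < b\<close> vertices of \<open>M\<close> are deleted, then at least
  \<open>a + j\<close> vertices are deleted in all and at most \<open>j + 1\<close> components
  remain. The ratio \<open>(a + j) / (j + 1)\<close> does not increase with \<open>j\<close>, so
  \<open>j = b - 1\<close> is the worst case; deleting all of \<open>M\<close> leaves at most
  \<open>b\<close> components. Denominators are cleared to stay in \<open>nat\<close>.\<close>

lemma matched_cutset_bound:
  assumes a: "a > 0" and S: "S \<subseteq> {..<a + 2 * b}"
    and c: "num_components_del {..<a + 2 * b} (matched_edges a b) S > 1"
  shows "(a + b - 1) * num_components_del {..<a + 2 * b} (matched_edges a b) S \<le> b * card S"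
proof -
  let ?V = "{..<a + 2 * b} - S"
  let ?E = "{e \<in> matched_edges a b. e \<subseteq> ?V}"
  let ?c = "num_components_del {..<a + 2 * b} (matched_edges a b) S"
  let ?M = "{a..<a + b}"
  have c_le: "?c \<le> card R" if "finite R" "\<And>v. v \<in> ?V \<Longrightarrow> \<exists>r\<in>R. (r, v) \<in> reachable ?V ?E" for R
    unfolding num_components_del_def using that by (rule card_components_le)
  have refl: "(v, v) \<in> reachable ?V ?E" if "v \<in> ?V" for v
    using that by (auto simp: reachable_def)
  have edge: "(u, v) \<in> reachable ?V ?E" if "u \<in> ?V" "v \<in> ?V" "{u, v} \<in> matched_edges a b" for u v
    using that by (intro reachable_edge) auto
  have finS: "finite S"
    using S finite_subset by blast
  \<comment> \<open>A surviving vertex of \<open>A\<close> is adjacent to all others, leaving a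
    single component.\<close>
  have AS: "{..<a} \<subseteq> S"
  proof (rule ccontr)
    assume "\<not> {..<a} \<subseteq> S"
    then obtain x where x: "x < a" "x \<in> ?V"
      by auto
    have "(x, v) \<in> reachable ?V ?E" if "v \<in> ?V" for v
      using x that refl edge matched_edges_hub[of x a v b] by (cases "v = x") auto
    then have "?c \<le> card {x}"
      by (intro c_le) auto
    then show False
      using c by simp
  qed
  define j where "j = card (?M \<inter> S)"
  have "a + j = card ({..<a} \<union> (?M \<inter> S))"
    unfolding j_def by (subst card_Un_disjoint) auto
  also have "\<dots> \<le> card S"
    using AS finS by (intro card_mono) auto
  finally have S_ge: "a + j \<le> card S" .
  show ?thesis
  proof (cases "?M \<subseteq> S")
    case True
    then have "j = b"
      by (simp add: j_def Int_absorb2)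
    moreover have "?c \<le> card {a + b..<a + 2 * b}"
    proof (rule c_le)
      fix v assume v: "v \<in> ?V"
      then have "v \<in> {a + b..<a + 2 * b}"
        using AS True by (auto simp: subset_iff not_less[symmetric])
      then show "\<exists>r\<in>{a + b..<a + 2 * b}. (r, v) \<in> reachable ?V ?E"
        using refl[OF v] by blast
    qed simp
    ultimately show ?thesis
      using S_ge by (subst mult.commute) (intro mult_le_mono; simp)
  next
    case False
    then obtain m where m: "m \<in> ?M" "m \<notin> S"
      by blast
    have "?M \<inter> S \<subset> ?M"
      using m by blast
    then have "j < card ?M"
      unfolding j_def by (intro psubset_card_mono) auto
    then have j: "j < b"
      by simp
    \<comment> \<open>\<open>m\<close> represents the rest of the clique together with the vertices
      of \<open>B\<close> whose partner survives; a vertex of \<open>B\<close> with deleted partner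
      represents itself.\<close>
    let ?R = "insert m ((\<lambda>u. u + b) ` (?M \<inter> S))"
    have "?c \<le> card ?R"
    proof (rule c_le)
      fix v assume v: "v \<in> ?V"
      have mV: "m \<in> ?V"
        using m by auto
      have to_m: "(m, u) \<in> reachable ?V ?E" if "u \<in> ?M" "u \<notin> S" for u
        using that m mV refl[of m] edge[of m u] matched_edges_clique[of m a b u]
        by (cases "u = m") auto
      have "a \<le> v" "v < a + 2 * b"
        using v AS by (auto simp: not_less[symmetric])
      then have "v \<in> ?M \<or> (v - b \<in> ?M \<and> v = v - b + b)"
        by auto
      then consider "v \<in> ?M" | u where "u \<in> ?M" "v = u + b"
        by blast
      then show "\<exists>r\<in>?R. (r, v) \<in> reachable ?V ?E"
      proof cases
        case 1
        then show ?thesis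
          using to_m v by auto
      next
        case 2
        show ?thesis
        proof (cases "u \<in> S")
          case True
          then show ?thesis
            using 2 refl[OF v] by blast
        next
          case False
          have "(u, v) \<in> reachable ?V ?E"
            using 2 v False j by (intro edge) (auto simp: matched_edges_iff)
          then have "(m, v) \<in> reachable ?V ?E"
            using to_m[of u] 2 False equiv_reachable[of ?V ?E] by (meson equivE transD)
          then show ?thesis
            by blast
        qed
      qed
    qed simp
    also have "card ?R \<le> Suc j"
      using card_image_le[of "?M \<inter> S" "\<lambda>u. u + b"]
      by (simp add: card_insert_if j_def)
    finally have "(a + b - 1) * ?c \<le> (a + b - 1) * Suc j"
      by (rule mult_le_mono2)
    also have "\<dots> \<le> b * (a + j)"
    proof -
      \<comment> \<open>In these variables the right side exceeds the left by exactly
        \<open>a' * k\<close>.\<close>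
      obtain a' where a': "a = Suc a'"
        using a gr0_conv_Suc by blast
      obtain k where k: "b = Suc (j + k)"
        using j less_iff_Suc_add by blast
      show ?thesis
        unfolding a' k by (simp add: algebra_simps)
    qed
    also have "\<dots> \<le> b * card S"
      using S_ge by simp
    finally show ?thesis .
  qed
qed

theorem theorem6:
  fixes \<epsilon> :: real
  assumes "\<epsilon> > 0"
  shows "\<exists>(V :: nat set) E. simple_graph V E \<and> connected_graph V E \<and>
           \<not> resistance_nonnegative V E \<and> toughness V E > ereal (3 / 2 - \<epsilon>)"
proof -
  obtain n where n: "3 / \<epsilon> < real n"
    using reals_Archimedean2 by blast
  \<comment> \<open>\<open>2 * a + 3\<close> is the least \<open>b\<close> that rules out RN. Then
    \<open>(a + b - 1) / b\<close> is \<open>3 / 2 - 5 / (4 * a + 6)\<close>, and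
    \<open>\<epsilon> * a > 3\<close> makes the defect smaller than
    \<open>\<epsilon>\<close>.\<close>
  define a b where "a = Suc n" and "b = 2 * a + 3"
  let ?V = "{..<a + 2 * b}"
  let ?E = "matched_edges a b"
  have a: "a > 0" "\<epsilon> * real a > 3"
    using n assms by (simp_all add: a_def field_simps)
  obtain T where "T \<subseteq> ?E" "connected_graph ?V T"
    using spanning_trees_matched_nonempty[OF a(1), of b] by (auto simp: spanning_trees_def)
  then have "connected_graph ?V ?E"
    using connected_graph_mono by blast
  moreover have "toughness ?V ?E > ereal (3 / 2 - \<epsilon>)"
  proof (rule toughness_greaterI[OF simple_graph_matched])
    fix S assume S: "S \<subseteq> ?V" "num_components_del ?V ?E S > 1"
    let ?c = "num_components_del ?V ?E S"
    have "3 / 2 - \<epsilon> < real (a + b - 1) / real b"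
      using a assms by (simp add: b_def field_simps)
    also have "real (a + b - 1) / real b \<le> real (card S) / real ?c"
    proof -
      have "real ((a + b - 1) * ?c) \<le> real (b * card S)"
        using matched_cutset_bound[OF a(1) S] by (rule of_nat_mono)
      then have "real (a + b - 1) * real ?c \<le> real (card S) * real b"
        by (simp only: of_nat_mult mult.commute)
      moreover have "real b > 0" "real ?c > 0"
        using S(2) by (simp_all add: b_def)
      ultimately show ?thesis
        by (simp add: pos_le_divide_eq pos_divide_le_eq del: of_nat_mult of_nat_diff)
    qed
    finally show "3 / 2 - \<epsilon> < real (card S) / real ?c" .
  qed
  ultimately show ?thesis
    using simple_graph_matched[of a b] not_resistance_nonnegative_matched[of a b] a(1)
    by (intro exI[of _ ?V] exI[of _ ?E]) (simp add: b_def)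
qed

end
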